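(* Let $\mathfrak{g}$ be a finite dimensional real Lie algebra, let $\mathfrak{h}$ be a Lie subalgebra of $\mathfrak{g}$ and fix $\lambda\in\mathfrak{g}^*$. Let $\mathfrak{h}^{\circ}\subset\mathfrak{g}^*$ be the annihilator of $\mathfrak{h}$. Then the affine subspace $C:=\mathfrak{h}^{\circ}+\lambda$ of the Poisson manifold $\mathfrak{g}^*$ is always pre-Poisson, and it is coisotropic if and only if $\lambda$ is a character of $\mathfrak{h}$, i.e. $\lambda\in[\mathfrak{h},\mathfrak{h}]^{\circ}$.
   Context: The dual $\mathfrak{g}^*$ of a finite dimensional Lie algebra is a Poisson manifold: identifying linear functions on $\mathfrak{g}^*$ with elements of $\mathfrak{g}$, the Poisson bracket is determined by $\{v_1,v_2\}:=[v_1,v_2]$ for $v_1,v_2\in\mathfrak{g}$ and the Leibniz rule. For a Poisson manifold $(P,\Pi)$ with $\{f,g\}=\Pi(df,dg)$, the map $\sharp\colon T^*P\to TP$ is contraction with $\Pi$, so $dg(\sharp df)=\{f,g\}$. For a submanifold $C\subset P$, $N^*C\subset T^*P|_C$ denotes the annihilator of $TC$. The submanifold $C$ is coisotropic if $\sharp N^*C\subset TC$, and pre-Poisson if the rank of $TC+\sharp N^*C$ is constant along $C$. For a linear subspace $V\subset\mathfrak{g}$, $V^{\circ}\subset\mathfrak{g}^*$ denotes its annihilator; $[\mathfrak{h},\mathfrak{h}]$ is the linear span of brackets of elements of $\mathfrak{h}$. *)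

theory Defs
  imports "HOL-Analysis.Analysis"
begin

section \<open>Lie algebras\<close>

text \<open>
  A finite dimensional real vector space is a type of class \<open>real_normed_vector\<close> that is spanned by
  a finite set. Unlike \<open>euclidean_space\<close> this fixes no inner product or basis and admits the zero
  space. The norm is auxiliary: every such space has one, any two are equivalent, and every linear
  functional is bounded (\<open>bounded_linear_finite_dim\<close>), so that \<^typ>\<open>'a \<Rightarrow>\<^sub>L real\<close> is the full
  algebraic dual.
\<close>

definition finite_dim :: "'a::real_vector itself \<Rightarrow> bool" where
  "finite_dim _ \<longleftrightarrow> (\<exists>B::'a set. finite B \<and> span B = UNIV)"

definition lie_bracket :: "('a::real_vector \<Rightarrow> 'a \<Rightarrow> 'a) \<Rightarrow> bool" where
  "lie_bracket br \<longleftrightarrow>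
     bilinear br \<and>
     (\<forall>x. br x x = 0) \<and>
     (\<forall>x y z. br x (br y z) + br y (br z x) + br z (br x y) = 0)"

definition lie_subalgebra :: "('a::real_vector \<Rightarrow> 'a \<Rightarrow> 'a) \<Rightarrow> 'a set \<Rightarrow> bool" where
  "lie_subalgebra br h \<longleftrightarrow> subspace h \<and> (\<forall>x\<in>h. \<forall>y\<in>h. br x y \<in> h)"

definition bracket_span :: "('a::real_vector \<Rightarrow> 'a \<Rightarrow> 'a) \<Rightarrow> 'a set \<Rightarrow> 'a set \<Rightarrow> 'a set" where
  "bracket_span br U V = span {br x y |x y. x \<in> U \<and> y \<in> V}"

definition annihilator :: "'a::real_normed_vector set \<Rightarrow> ('a \<Rightarrow>\<^sub>L real) set" where
  "annihilator V = {\<phi>. \<forall>v\<in>V. blinfun_apply \<phi> v = 0}"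


section \<open>Bivector fields and submanifolds\<close>

text \<open>
  The manifold is a finite dimensional space \<^typ>\<open>'p::real_normed_vector\<close>, so all its tangent
  spaces are \<^typ>\<open>'p\<close> and all its cotangent spaces are \<^typ>\<open>'p \<Rightarrow>\<^sub>L real\<close>. A bivector field assigns to
  each point a skew bilinear form on covectors; the type synonym does not enforce this, see
  \<open>lie_poisson_skew_bilinear\<close> for the case used here.
\<close>

type_synonym 'p bivector_field = "'p \<Rightarrow> ('p \<Rightarrow>\<^sub>L real) \<Rightarrow> ('p \<Rightarrow>\<^sub>L real) \<Rightarrow> real"

definition differential :: "('p::real_normed_vector \<Rightarrow> real) \<Rightarrow> 'p \<Rightarrow> 'p \<Rightarrow>\<^sub>L real" where
  "differential f p = Blinfun (frechet_derivative f (at p))"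

definition poisson_bracket ::
  "'p::real_normed_vector bivector_field \<Rightarrow> ('p \<Rightarrow> real) \<Rightarrow> ('p \<Rightarrow> real) \<Rightarrow> 'p \<Rightarrow> real" where
  "poisson_bracket P f g p = P p (differential f p) (differential g p)"

definition sharp :: "'p::real_normed_vector bivector_field \<Rightarrow> 'p \<Rightarrow> ('p \<Rightarrow>\<^sub>L real) \<Rightarrow> 'p" where
  "sharp P p \<xi> = (THE X. \<forall>\<eta>. blinfun_apply \<eta> X = P p \<xi> \<eta>)"

text \<open>
  Velocities at \<open>p\<close> of curves that stay in \<open>C\<close> near time \<open>0\<close>; for an embedded submanifold \<open>C\<close> this is
  its tangent space at \<open>p\<close>. The notions below are meant for submanifolds \<open>C\<close>.
\<close>

definition tangent_space :: "'p::real_normed_vector set \<Rightarrow> 'p \<Rightarrow> 'p set" where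
  "tangent_space C p =
     {X. \<exists>\<gamma>. \<gamma> 0 = p \<and> (\<forall>\<^sub>F t in nhds (0::real). \<gamma> t \<in> C) \<and> (\<gamma> has_vector_derivative X) (at 0)}"

definition conormal_space :: "'p::real_normed_vector set \<Rightarrow> 'p \<Rightarrow> ('p \<Rightarrow>\<^sub>L real) set" where
  "conormal_space C p = annihilator (tangent_space C p)"

definition coisotropic :: "'p::real_normed_vector bivector_field \<Rightarrow> 'p set \<Rightarrow> bool" where
  "coisotropic P C \<longleftrightarrow> (\<forall>p\<in>C. sharp P p ` conormal_space C p \<subseteq> tangent_space C p)"

definition pre_Poisson :: "'p::real_normed_vector bivector_field \<Rightarrow> 'p set \<Rightarrow> bool" where
  "pre_Poisson P C \<longleftrightarrow>
     (\<exists>r. \<forall>p\<in>C.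
        dim {X + Y |X Y. X \<in> tangent_space C p \<and> Y \<in> sharp P p ` conormal_space C p} = r)"


section \<open>The Poisson structure on the dual of a Lie algebra\<close>

text \<open>
  The linear function on the dual given by an element of the Lie algebra. In finite dimensions \<open>ev\<close>
  is a bijection onto the bidual (\<open>bij_ev\<close>), which is every cotangent space of the dual.
\<close>

definition ev :: "'a::real_normed_vector \<Rightarrow> ('a \<Rightarrow>\<^sub>L real) \<Rightarrow>\<^sub>L real" where
  "ev v = Blinfun (\<lambda>\<mu>. blinfun_apply \<mu> v)"

definition lie_poisson ::
  "('a::real_normed_vector \<Rightarrow> 'a \<Rightarrow> 'a) \<Rightarrow> ('a \<Rightarrow>\<^sub>L real) bivector_field" where
  "lie_poisson br \<mu> \<xi> \<eta> = blinfun_apply \<mu> (br (inv ev \<xi>) (inv ev \<eta>))"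

text \<open>
  The lemmas at the end show that this is the Poisson structure determined by
  \<open>{v, w} = [v, w]\<close> on linear functions and the Leibniz rule, and that \<open>sharp\<close> satisfies
  \<open>dg (sharp df) = {f, g}\<close>.
\<close>

lemma finite_dim_basis:
  assumes "finite_dim TYPE('a::real_vector)"
  obtains B :: "'a::real_vector set" where "finite B" "independent B" "span B = UNIV"
proof -
  obtain S :: "'a set" where S: "finite S" "span S = UNIV"
    using assms unfolding finite_dim_def by blast
  obtain B where B: "B \<subseteq> S" "independent B" "S \<subseteq> span B"
    using maximal_independent_subset[of S] by blast
  have "span B = UNIV"
    using B(3) S(2) span_mono[OF B(3)] by (simp add: span_span top.extremum_unique)
  with B S show ?thesis using that finite_subset by blast
qed

lemma coefficient_bound:
  fixes B :: "'a::real_normed_vector set"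
  assumes fin: "finite B" and ind: "independent B"
  obtains m where "m > 0" "\<And>u. m * (\<Sum>b\<in>B. \<bar>u b\<bar>) \<le> norm (\<Sum>b\<in>B. u b *\<^sub>R b)"
proof -
  define K :: "('a \<Rightarrow> real) set" where "K = PiE UNIV (\<lambda>b. if b \<in> B then {-1..1} else {0})"
  define S where "S = K \<inter> {u. (\<Sum>b\<in>B. \<bar>u b\<bar>) = 1}"
  have "compactin (product_topology (\<lambda>_. euclidean) UNIV) K"
    unfolding K_def compactin_PiE by (simp add: compactin_euclidean_iff)
  then have K: "compact K"
    by (simp add: euclidean_product_topology flip: compactin_euclidean_iff)
  have cont1: "continuous_on UNIV (\<lambda>u::'a \<Rightarrow> real. \<Sum>b\<in>B. \<bar>u b\<bar>)"
    by (intro continuous_intros continuous_on_product_coordinates)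
  have cont2: "continuous_on UNIV (\<lambda>u::'a \<Rightarrow> real. norm (\<Sum>b\<in>B. u b *\<^sub>R b))"
    by (intro continuous_intros continuous_on_product_coordinates)
  have "closed {u::'a \<Rightarrow> real. (\<Sum>b\<in>B. \<bar>u b\<bar>) = 1}"
    using closed_Collect_eq[OF cont1 continuous_on_const] by simp
  then have S: "compact S" unfolding S_def using K by (rule compact_Int_closed[rotated])
  have nz: "norm (\<Sum>b\<in>B. u b *\<^sub>R b) > 0" if "u \<in> S" for u
  proof (rule ccontr)
    assume "\<not> ?thesis"
    then have "(\<Sum>b\<in>B. u b *\<^sub>R b) = 0" by simp
    then have "\<forall>b\<in>B. u b = 0"
      using independentD[OF ind fin subset_refl] by blast
    then have "(\<Sum>b\<in>B. \<bar>u b\<bar>) = 0" by simp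
    with that show False by (simp add: S_def)
  qed
  have "\<exists>m>0. \<forall>u\<in>S. m \<le> norm (\<Sum>b\<in>B. u b *\<^sub>R b)"
  proof (cases "S = {}")
    case True
    then show ?thesis by (intro exI[of _ 1]) auto
  next
    case False
    from continuous_attains_inf[OF S False continuous_on_subset[OF cont2 subset_UNIV]] nz
    show ?thesis by blast
  qed
  then obtain m where m: "m > 0" "\<And>u. u \<in> S \<Longrightarrow> m \<le> norm (\<Sum>b\<in>B. u b *\<^sub>R b)" by blast
  show ?thesis
  proof (rule that[OF m(1)])
    fix u :: "'a \<Rightarrow> real"
    define s where "s = (\<Sum>b\<in>B. \<bar>u b\<bar>)"
    show "m * (\<Sum>b\<in>B. \<bar>u b\<bar>) \<le> norm (\<Sum>b\<in>B. u b *\<^sub>R b)"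
    proof (cases "s = 0")
      case True
      then show ?thesis by (simp add: s_def)
    next
      case False
      then have s: "s > 0" 
        using sum_nonneg[of B "\<lambda>b. \<bar>u b\<bar>"] by (simp add: s_def less_le)
      define w where "w = (\<lambda>b. if b \<in> B then u b / s else 0)"
      have le: "\<bar>u b\<bar> \<le> s" if "b \<in> B" for b
        unfolding s_def using fin that by (intro member_le_sum) auto
      have "w \<in> K"
        using s le by (force simp: K_def w_def field_simps abs_le_iff)
      moreover have "(\<Sum>b\<in>B. \<bar>w b\<bar>) = 1"
      proof -
        have "(\<Sum>b\<in>B. \<bar>w b\<bar>) = (\<Sum>b\<in>B. \<bar>u b\<bar>) / s"
          unfolding sum_divide_distrib using s by (intro sum.cong) (auto simp: w_def)
        then show ?thesis using s by (simp add: s_def)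
      qed
      ultimately have "m \<le> norm (\<Sum>b\<in>B. w b *\<^sub>R b)" by (intro m(2)) (simp add: S_def)
      also have "(\<Sum>b\<in>B. w b *\<^sub>R b) = (1 / s) *\<^sub>R (\<Sum>b\<in>B. u b *\<^sub>R b)"
        unfolding scaleR_sum_right by (intro sum.cong) (auto simp: w_def)
      finally show ?thesis using s by (simp add: s_def field_simps)
    qed
  qed
qed

lemma bounded_linear_finite_dim:
  fixes f :: "'a::real_normed_vector \<Rightarrow> 'b::real_normed_vector"
  assumes "finite_dim TYPE('a)" "linear f"
  shows "bounded_linear f"
proof -
  obtain B :: "'a set" where B: "finite B" "independent B" "span B = UNIV"
    using finite_dim_basis[OF assms(1)] .
  obtain m where m: "m > 0" "\<And>u. m * (\<Sum>b\<in>B. \<bar>u b\<bar>) \<le> norm (\<Sum>b\<in>B. u b *\<^sub>R b)"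
    using coefficient_bound[OF B(1,2)] by blast
  define M where "M = (\<Sum>b\<in>B. norm (f b))"
  have "norm (f x) \<le> norm x * (M / m)" for x
  proof -
    obtain u where x: "x = (\<Sum>b\<in>B. u b *\<^sub>R b)"
      using span_finite[OF B(1)] B(3) by blast
    have "norm (f x) \<le> (\<Sum>b\<in>B. \<bar>u b\<bar> * norm (f b))"
      unfolding x linear_sum[OF assms(2)] linear_scale[OF assms(2)]
      by (rule order_trans[OF norm_sum]) simp
    also have "\<dots> \<le> (\<Sum>b\<in>B. \<bar>u b\<bar> * M)"
      unfolding M_def using B(1) by (intro sum_mono mult_left_mono member_le_sum) auto
    also have "\<dots> = (\<Sum>b\<in>B. \<bar>u b\<bar>) * M" by (simp add: sum_distrib_right)
    also have "\<dots> \<le> (norm x / m) * M"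
      using m(1) m(2)[of u] by (intro mult_right_mono)
        (auto simp: x M_def field_simps sum_nonneg)
    finally show ?thesis by (simp add: field_simps)
  qed
  then show ?thesis using assms(2)
    unfolding bounded_linear_def bounded_linear_axioms_def by blast
qed

lemma ev_apply [simp]: "blinfun_apply (ev v) \<mu> = blinfun_apply \<mu> v"
  unfolding ev_def by (simp add: bounded_linear_Blinfun_apply blinfun.bounded_linear_left)

lemma bij_ev:
  assumes "finite_dim TYPE('a::real_normed_vector)"
  shows "bij (ev :: 'a \<Rightarrow> _)"
proof -
  obtain B :: "'a set" where B: "finite B" "independent B" "span B = UNIV"
    using finite_dim_basis[OF assms] .
  define c where "c = (\<lambda>b. Blinfun (\<lambda>x. representation B x b))"
  have c: "blinfun_apply (c b) x = representation B x b" for b x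
  proof -
    have "linear (\<lambda>x. representation B x b)"
      by (rule linearI) (simp_all add: B representation_add representation_scale)
    then show ?thesis
      unfolding c_def by (simp add: bounded_linear_Blinfun_apply bounded_linear_finite_dim assms)
  qed
  have rep: "x = (\<Sum>b\<in>B. representation B x b *\<^sub>R b)" for x
    using sum_representation_eq[of B x B] B by simp
  have "v = w" if "ev v = ev w" for v w :: 'a
  proof -
    have "representation B v b = representation B w b" for b
      using that c by (metis ev_apply)
    then show ?thesis using rep[of v] rep[of w] by simp
  qed
  moreover have "\<exists>v. \<xi> = ev v" for \<xi> :: "('a \<Rightarrow>\<^sub>L real) \<Rightarrow>\<^sub>L real"
  proof -
    have "blinfun_apply \<xi> \<mu> = blinfun_apply \<mu> (\<Sum>b\<in>B. blinfun_apply \<xi> (c b) *\<^sub>R b)" for \<mu>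
    proof -
      have "\<mu> = (\<Sum>b\<in>B. blinfun_apply \<mu> b *\<^sub>R c b)"
      proof (rule blinfun_eqI)
        fix x
        have "blinfun_apply \<mu> x = (\<Sum>b\<in>B. representation B x b * blinfun_apply \<mu> b)"
          by (subst rep[of x]) (simp add: blinfun.sum_right blinfun.scaleR_right)
        then show "blinfun_apply \<mu> x = blinfun_apply (\<Sum>b\<in>B. blinfun_apply \<mu> b *\<^sub>R c b) x"
          by (simp add: blinfun.sum_left blinfun.scaleR_left c mult.commute)
      qed
      then have "blinfun_apply \<xi> \<mu> = blinfun_apply \<xi> (\<Sum>b\<in>B. blinfun_apply \<mu> b *\<^sub>R c b)"
        by (rule arg_cong)
      then show ?thesis
        by (simp add: blinfun.sum_right blinfun.scaleR_right mult.commute)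
    qed
    then show ?thesis by (intro exI, intro blinfun_eqI, unfold ev_apply)
  qed
  ultimately show ?thesis unfolding bij_def inj_def surj_def by blast
qed

lemma differential_eqI:
  assumes "(f has_derivative blinfun_apply \<xi>) (at p)"
  shows "differential f p = \<xi>"
  unfolding differential_def by (simp add: frechet_derivative_at[OF assms, symmetric] blinfun_apply_inverse)

lemma has_derivative_differential:
  assumes "f differentiable (at p)"
  shows "(f has_derivative blinfun_apply (differential f p)) (at p)"
proof -
  have D: "(f has_derivative frechet_derivative f (at p)) (at p)"
    using assms by (simp add: frechet_derivative_works)
  then show ?thesis
    by (simp add: differential_def bounded_linear_Blinfun_apply[OF has_derivative_bounded_linear[OF D]])
qed

lemma lie_poisson_ev:
  assumes "finite_dim TYPE('a::real_normed_vector)"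
  shows "lie_poisson br \<mu> (ev v) (ev (w::'a)) = blinfun_apply \<mu> (br v w)"
  using bij_is_inj[OF bij_ev[OF assms]] by (simp add: lie_poisson_def)

lemma poisson_bracket_linear_functions:
  assumes "finite_dim TYPE('a::real_normed_vector)"
  shows "poisson_bracket (lie_poisson br) (blinfun_apply (ev v)) (blinfun_apply (ev (w::'a)))
    = blinfun_apply (ev (br v w))"
proof -
  have "differential (blinfun_apply (ev v)) \<mu> = ev v" for v :: 'a and \<mu>
    by (intro differential_eqI bounded_linear_imp_has_derivative blinfun.bounded_linear_right)
  then show ?thesis
    by (simp add: fun_eq_iff poisson_bracket_def lie_poisson_ev[OF assms])
qed

lemma lie_poisson_skew_bilinear:
  assumes "finite_dim TYPE('a::real_normed_vector)" "lie_bracket (br :: 'a \<Rightarrow> 'a \<Rightarrow> 'a)"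
  shows "bilinear (lie_poisson br \<mu>)" "lie_poisson br \<mu> \<xi> \<xi> = 0"
proof -
  have bil: "bilinear br" using assms(2) by (simp add: lie_bracket_def)
  have inj: "inj (ev :: 'a \<Rightarrow> _)" using bij_ev[OF assms(1)] by (rule bij_is_inj)
  have inv: "blinfun_apply \<mu> (inv ev \<xi>) = blinfun_apply \<xi> \<mu>"
    for \<xi> :: "('a \<Rightarrow>\<^sub>L real) \<Rightarrow>\<^sub>L real" and \<mu>
    using surj_f_inv_f[OF bij_is_surj[OF bij_ev[OF assms(1)]], of \<xi>] by (metis ev_apply)
  have add: "inv ev (\<xi> + \<eta>) = inv ev \<xi> + (inv ev \<eta> :: 'a)" for \<xi> \<eta>
    by (rule inv_f_eq[OF inj], rule blinfun_eqI)
      (simp add: blinfun.bilinear_simps inv)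
  have scale: "inv ev (c *\<^sub>R \<xi>) = c *\<^sub>R (inv ev \<xi> :: 'a)" for c \<xi>
    by (rule inv_f_eq[OF inj], rule blinfun_eqI)
      (simp add: blinfun.bilinear_simps inv)
  show "bilinear (lie_poisson br \<mu>)"
    unfolding bilinear_def lie_poisson_def
    by (intro conjI allI linearI)
      (simp_all add: add scale bilinear_ladd[OF bil] bilinear_radd[OF bil] bilinear_lmul[OF bil]
        bilinear_rmul[OF bil] blinfun.add_right blinfun.scaleR_right)
  show "lie_poisson br \<mu> \<xi> \<xi> = 0"
    using assms(2) by (simp add: lie_bracket_def lie_poisson_def)
qed

lemma poisson_bracket_Leibniz:
  assumes "finite_dim TYPE('a::real_normed_vector)" "lie_bracket (br :: 'a \<Rightarrow> 'a \<Rightarrow> 'a)"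
    and g: "g differentiable (at \<mu>)" and k: "k differentiable (at \<mu>)"
  shows "poisson_bracket (lie_poisson br) f (\<lambda>x. g x * k x) \<mu>
    = poisson_bracket (lie_poisson br) f g \<mu> * k \<mu> + g \<mu> * poisson_bracket (lie_poisson br) f k \<mu>"
proof -
  have "differential (\<lambda>x. g x * k x) \<mu> = k \<mu> *\<^sub>R differential g \<mu> + g \<mu> *\<^sub>R differential k \<mu>"
    by (rule differential_eqI)
      (rule has_derivative_eq_rhs[OF has_derivative_mult[OF has_derivative_differential[OF g]
          has_derivative_differential[OF k]]],
       simp add: fun_eq_iff blinfun.bilinear_simps)
  then show ?thesis
    using lie_poisson_skew_bilinear(1)[OF assms(1,2), of \<mu>]
    by (simp add: poisson_bracket_def bilinear_radd bilinear_rmul)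
qed

lemma sharp_lie_poisson:
  assumes fd: "finite_dim TYPE('a::real_normed_vector)" and "lie_bracket (br :: 'a \<Rightarrow> 'a \<Rightarrow> 'a)"
  shows "blinfun_apply \<eta> (sharp (lie_poisson br) \<mu> \<xi>) = lie_poisson br \<mu> \<xi> \<eta>"
proof -
  define v where "v = inv ev \<xi>"
  have ev: "\<exists>w. \<eta> = ev w" for \<eta> :: "('a \<Rightarrow>\<^sub>L real) \<Rightarrow>\<^sub>L real"
    using bij_is_surj[OF bij_ev[OF fd]] by (auto simp: surj_def)
  have "linear (br v)" using assms(2) by (simp add: lie_bracket_def bilinear_def)
  then have "bounded_linear (\<lambda>w. blinfun_apply \<mu> (br v w))"
    by (intro bounded_linear_finite_dim[OF fd] linearI)
      (simp_all add: linear_add[OF \<open>linear (br v)\<close>] linear_scale[OF \<open>linear (br v)\<close>]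
        blinfun.add_right blinfun.scaleR_right)
  note X = bounded_linear_Blinfun_apply[OF this]
  have "\<forall>\<eta>. blinfun_apply \<eta> (sharp (lie_poisson br) \<mu> \<xi>) = lie_poisson br \<mu> \<xi> \<eta>"
    unfolding sharp_def
  proof (rule theI)
    show "\<forall>\<eta>. blinfun_apply \<eta> (Blinfun (\<lambda>w. blinfun_apply \<mu> (br v w))) = lie_poisson br \<mu> \<xi> \<eta>"
    proof
      fix \<eta> :: "('a \<Rightarrow>\<^sub>L real) \<Rightarrow>\<^sub>L real"
      obtain w where "\<eta> = ev w" using ev by blast
      then show "blinfun_apply \<eta> (Blinfun (\<lambda>w. blinfun_apply \<mu> (br v w))) = lie_poisson br \<mu> \<xi> \<eta>"
        using bij_is_inj[OF bij_ev[OF fd]] by (simp add: lie_poisson_def X v_def[symmetric])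
    qed
  next
    fix Y assume Y: "\<forall>\<eta>. blinfun_apply \<eta> Y = lie_poisson br \<mu> \<xi> \<eta>"
    show "Y = Blinfun (\<lambda>w. blinfun_apply \<mu> (br v w))"
    proof (rule blinfun_eqI)
      fix w
      have "blinfun_apply Y w = lie_poisson br \<mu> \<xi> (ev w)" using Y by (metis ev_apply)
      then show "blinfun_apply Y w = blinfun_apply (Blinfun (\<lambda>w. blinfun_apply \<mu> (br v w))) w"
        using bij_is_inj[OF bij_ev[OF fd]] by (simp add: lie_poisson_def X v_def[symmetric])
    qed
  qed
  then show ?thesis by blast
qed

corollary differential_sharp:
  assumes "finite_dim TYPE('a::real_normed_vector)" "lie_bracket (br :: 'a \<Rightarrow> 'a \<Rightarrow> 'a)"
  shows "blinfun_apply (differential g \<mu>) (sharp (lie_poisson br) \<mu> (differential f \<mu>))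
    = poisson_bracket (lie_poisson br) f g \<mu>"
  by (simp add: sharp_lie_poisson[OF assms] poisson_bracket_def)

end

theory Submission
  imports Defs
begin

text \<open>
  Write \<open>h\<^sup>\<circ>\<close> for the annihilator of \<open>h\<close>. Every tangent space of \<open>C = h\<^sup>\<circ> + \<lambda>\<close> is \<open>h\<^sup>\<circ>\<close>
  (\<open>tangent_space_translate\<close>), so every conormal space is the double annihilator of \<open>h\<close>, which in
  finite dimensions is a copy of \<open>h\<close> itself inside the bidual (\<open>annihilator_annihilator\<close>). At a
  point \<open>\<mu>\<close> the map \<open>\<sharp>\<close> sends the covector given by \<open>v\<close> to the functional
  \<open>w \<mapsto> \<mu> [v, w]\<close> (\<open>sharp_lie_poisson_ev\<close>).

  Both claims come from comparing the point \<open>\<mu> = \<phi> + \<lambda>\<close> of \<open>C\<close>, where \<open>\<phi> \<in> h\<^sup>\<circ>\<close>, with the base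
  point \<open>\<lambda>\<close>. For \<open>v \<in> h\<close> the functional \<open>w \<mapsto> \<phi> [v, w]\<close> vanishes on \<open>h\<close>, because \<open>h\<close> is closed
  under brackets (\<open>sharp_in_annihilator\<close>). Hence \<open>\<sharp> v\<close> at \<open>\<mu>\<close> and \<open>\<sharp> v\<close> at \<open>\<lambda>\<close> differ by a vector
  tangent to \<open>C\<close>. So the space \<open>TC + \<sharp> N\<^sup>*C\<close>, and not only its dimension, is the same at all
  points of \<open>C\<close>. It also follows that \<open>\<sharp> N\<^sup>*C \<subseteq> TC\<close> holds along \<open>C\<close> as soon as it holds at \<open>\<lambda>\<close>,
  where it says that \<open>\<lambda> [v, w] = 0\<close> for all \<open>v, w \<in> h\<close>.
\<close>

section \<open>Annihilators\<close>

lemma subspace_annihilator: "subspace (annihilator V)"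
  unfolding subspace_def annihilator_def by (auto simp: blinfun.bilinear_simps)

lemma closed_annihilator: "closed (annihilator V)"
proof -
  have "annihilator V = (\<Inter>v\<in>V. {\<phi>. blinfun_apply \<phi> v = 0})"
    by (auto simp: annihilator_def)
  then show ?thesis
    by (auto intro!: closed_INT closed_Collect_eq continuous_intros)
qed

lemma annihilator_bracket_span:
  "\<phi> \<in> annihilator (bracket_span br U V) \<longleftrightarrow> (\<forall>x\<in>U. \<forall>y\<in>V. blinfun_apply \<phi> (br x y) = 0)"
proof
  assume "\<phi> \<in> annihilator (bracket_span br U V)"
  then show "\<forall>x\<in>U. \<forall>y\<in>V. blinfun_apply \<phi> (br x y) = 0"
    unfolding annihilator_def bracket_span_def by (blast intro: span_base)
next
  assume "\<forall>x\<in>U. \<forall>y\<in>V. blinfun_apply \<phi> (br x y) = 0"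
  moreover have "linear (blinfun_apply \<phi>)"
    by (rule bounded_linear.linear[OF blinfun.bounded_linear_right])
  ultimately have "blinfun_apply \<phi> z = 0" if "z \<in> bracket_span br U V" for z
    using linear_eq_0_on_span[of "blinfun_apply \<phi>" "{br x y |x y. x \<in> U \<and> y \<in> V}" z] that
    unfolding bracket_span_def by blast
  then show "\<phi> \<in> annihilator (bracket_span br U V)"
    by (simp add: annihilator_def)
qed

text \<open>
  A point outside a subspace is independent of any basis of it, so a functional may be prescribed
  to be \<open>0\<close> on the basis and \<open>1\<close> at the point.
\<close>

lemma annihilator_separates:
  fixes h :: "'a::real_normed_vector set"
  assumes fd: "finite_dim TYPE('a)" and h: "subspace h" and v: "v \<notin> h"
  obtains \<mu> where "\<mu> \<in> annihilator h" "blinfun_apply \<mu> v \<noteq> 0"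
proof -
  obtain B where B: "B \<subseteq> h" "independent B" "h \<subseteq> span B"
    using maximal_independent_subset[of h] by blast
  have vB: "v \<notin> span B"
    using v span_minimal[OF B(1) h] by blast
  then have "independent (insert v B)"
    using B(2) by (simp add: independent_insertI)
  from linear_independent_extend[OF this, of "\<lambda>x. if x = v then 1 else 0 :: real"]
  obtain g :: "'a \<Rightarrow> real" where g: "linear g" "\<And>x. x \<in> insert v B \<Longrightarrow> g x = (if x = v then 1 else 0)"
    by blast
  have app: "blinfun_apply (Blinfun g) x = g x" for x
    using bounded_linear_finite_dim[OF fd g(1)] by (simp add: bounded_linear_Blinfun_apply)
  have "v \<notin> B" using vB span_base by blast
  have "g b = 0" if "b \<in> B" for b
    using g(2)[of b] that \<open>v \<notin> B\<close> by (metis insertI2)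
  then have "g x = 0" if "x \<in> h" for x
    using linear_eq_0_on_span[OF g(1)] that B(3) by blast
  then have "Blinfun g \<in> annihilator h"
    by (simp add: annihilator_def app)
  moreover have "blinfun_apply (Blinfun g) v \<noteq> 0"
    using g(2)[of v] by (simp add: app)
  ultimately show ?thesis by (rule that)
qed

lemma annihilator_annihilator:
  fixes h :: "'a::real_normed_vector set"
  assumes fd: "finite_dim TYPE('a)" and h: "subspace h"
  shows "annihilator (annihilator h) = ev ` h"
proof
  show "ev ` h \<subseteq> annihilator (annihilator h)"
    by (auto simp: annihilator_def)
  show "annihilator (annihilator h) \<subseteq> ev ` h"
  proof
    fix \<xi> assume \<xi>: "\<xi> \<in> annihilator (annihilator h)"
    obtain v where v: "\<xi> = ev v"
      using bij_is_surj[OF bij_ev[OF fd]] by (auto simp: surj_def)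
    have "v \<in> h"
    proof (rule ccontr)
      assume "v \<notin> h"
      then obtain \<mu> where "\<mu> \<in> annihilator h" "blinfun_apply \<mu> v \<noteq> 0"
        using annihilator_separates[OF fd h] by blast
      with \<xi> show False by (simp add: v annihilator_def)
    qed
    with v show "\<xi> \<in> ev ` h" by blast
  qed
qed


section \<open>Tangent spaces of affine subspaces\<close>

text \<open>
  Difference quotients of a curve in the affine subspace lie in its direction \<open>S\<close>, and so does
  their limit since \<open>S\<close> is closed. Straight lines realise every vector of \<open>S\<close>.
\<close>

lemma tangent_space_translate:
  fixes S :: "'p::real_normed_vector set"
  assumes S: "subspace S" "closed S" and p: "p \<in> {x + a |x. x \<in> S}"
  shows "tangent_space {x + a |x. x \<in> S} p = S"
proof -
  have mem: "q \<in> {x + a |x. x \<in> S} \<longleftrightarrow> q - p \<in> S" for q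
  proof -
    obtain x where x: "x \<in> S" "p = x + a" using p by blast
    have "q \<in> {x + a |x. x \<in> S} \<longleftrightarrow> q - a \<in> S"
      by (auto intro: exI[of _ "q - a"])
    also have "\<dots> \<longleftrightarrow> q - p \<in> S"
    proof
      show "q - p \<in> S" if "q - a \<in> S"
        using subspace_diff[OF S(1) that x(1)] by (simp add: x(2) algebra_simps)
      show "q - a \<in> S" if "q - p \<in> S"
        using subspace_add[OF S(1) that x(1)] by (simp add: x(2) algebra_simps)
    qed
    finally show ?thesis .
  qed
  show ?thesis
  proof
    show "S \<subseteq> tangent_space {x + a |x. x \<in> S} p"
    proof
      fix X assume X: "X \<in> S"
      have "((\<lambda>t. p + t *\<^sub>R X) has_vector_derivative X) (at 0)"
        by (auto intro!: derivative_eq_intros)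
      moreover have "p + t *\<^sub>R X \<in> {x + a |x. x \<in> S}" for t
        using subspace_scale[OF S(1) X] by (subst mem) simp
      ultimately show "X \<in> tangent_space {x + a |x. x \<in> S} p"
        unfolding tangent_space_def by (intro CollectI exI[of _ "\<lambda>t. p + t *\<^sub>R X"]) simp
    qed
    show "tangent_space {x + a |x. x \<in> S} p \<subseteq> S"
    proof
      fix X assume "X \<in> tangent_space {x + a |x. x \<in> S} p"
      then obtain \<gamma> where \<gamma>: "\<gamma> 0 = p" "\<forall>\<^sub>F t in nhds (0::real). \<gamma> t \<in> {x + a |x. x \<in> S}"
        "(\<gamma> has_vector_derivative X) (at 0)"
        unfolding tangent_space_def by blast
      have lim: "((\<lambda>t. (1 / t) *\<^sub>R (\<gamma> t - p)) \<longlongrightarrow> X) (at 0)"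
      proof (rule LIM_zero_cancel, rule tendsto_norm_zero_cancel, rule Lim_transform_eventually)
        show "((\<lambda>t. norm (\<gamma> t - p - t *\<^sub>R X) / norm t) \<longlongrightarrow> 0) (at 0)"
          using \<gamma>(1,3) by (simp add: has_vector_derivative_def has_derivative_at)
        show "\<forall>\<^sub>F t in at 0. norm (\<gamma> t - p - t *\<^sub>R X) / norm t
          = norm ((1 / t) *\<^sub>R (\<gamma> t - p) - X)"
        proof (rule eventually_at_filter[THEN iffD2], rule always_eventually, intro allI impI)
          fix t :: real assume "t \<noteq> 0"
          then have "(1 / t) *\<^sub>R (\<gamma> t - p) - X = (1 / t) *\<^sub>R (\<gamma> t - p - t *\<^sub>R X)"
            by (simp add: algebra_simps)
          then show "norm (\<gamma> t - p - t *\<^sub>R X) / norm t = norm ((1 / t) *\<^sub>R (\<gamma> t - p) - X)"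
            by simp
        qed
      qed
      have "\<forall>\<^sub>F t in at (0::real). (1 / t) *\<^sub>R (\<gamma> t - p) \<in> S"
      proof (rule eventually_mono)
        show "\<forall>\<^sub>F t in at 0. \<gamma> t \<in> {x + a |x. x \<in> S}"
          using \<gamma>(2) by (simp add: eventually_at_filter eventually_mono)
        show "(1 / t) *\<^sub>R (\<gamma> t - p) \<in> S" if "\<gamma> t \<in> {x + a |x. x \<in> S}" for t
          using that subspace_scale[OF S(1)] mem by blast
      qed
      then show "X \<in> S"
        using Lim_in_closed_set[OF S(2) _ _ lim] by simp
    qed
  qed
qed


section \<open>The sharp map of the Lie-Poisson structure\<close>

lemma sharp_lie_poisson_ev:
  fixes br :: "'a::real_normed_vector \<Rightarrow> 'a \<Rightarrow> 'a"
  assumes "finite_dim TYPE('a)" "lie_bracket br"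
  shows "blinfun_apply (sharp (lie_poisson br) \<mu> (ev v)) w = blinfun_apply \<mu> (br v w)"
  using sharp_lie_poisson[OF assms, of "ev w" \<mu> "ev v"] lie_poisson_ev[OF assms(1), of br \<mu> v w]
  by simp

lemma sharp_lie_poisson_add:
  fixes br :: "'a::real_normed_vector \<Rightarrow> 'a \<Rightarrow> 'a"
  assumes "finite_dim TYPE('a)" "lie_bracket br"
  shows "sharp (lie_poisson br) (\<mu> + \<nu>) (ev v) =
    sharp (lie_poisson br) \<mu> (ev v) + sharp (lie_poisson br) \<nu> (ev v)"
  by (rule blinfun_eqI) (simp add: sharp_lie_poisson_ev[OF assms] blinfun.add_left)

text \<open>
  Up to sign, \<open>\<sharp>\<close> of the covector given by \<open>v\<close> is the coadjoint action of \<open>v\<close>. The adjoint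
  action of \<open>h\<close> preserves \<open>h\<close>, so dually its coadjoint action preserves the annihilator.
\<close>

lemma sharp_in_annihilator:
  fixes br :: "'a::real_normed_vector \<Rightarrow> 'a \<Rightarrow> 'a"
  assumes "finite_dim TYPE('a)" "lie_bracket br" "lie_subalgebra br h"
    and "\<phi> \<in> annihilator h" "v \<in> h"
  shows "sharp (lie_poisson br) \<phi> (ev v) \<in> annihilator h"
  using assms(3-5) by (simp add: annihilator_def lie_subalgebra_def sharp_lie_poisson_ev[OF assms(1,2)])

theorem proposition5p1:
  fixes br :: "'a::real_normed_vector \<Rightarrow> 'a \<Rightarrow> 'a"
    and h :: "'a set"
    and lam :: "'a \<Rightarrow>\<^sub>L real"
    and C :: "('a \<Rightarrow>\<^sub>L real) set"
  assumes "finite_dim TYPE('a)"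
    and "lie_bracket br"
    and "lie_subalgebra br h"
    and "C = {\<phi> + lam |\<phi>. \<phi> \<in> annihilator h}"
  shows "pre_Poisson (lie_poisson br) C \<and>
    (coisotropic (lie_poisson br) C \<longleftrightarrow> lam \<in> annihilator (bracket_span br h h))"
proof -
  let ?A = "annihilator h"
  let ?s = "\<lambda>\<mu> v. sharp (lie_poisson br) \<mu> (ev v)"
  have T: "tangent_space C p = ?A" if "p \<in> C" for p
    using tangent_space_translate[OF subspace_annihilator closed_annihilator] that
    unfolding assms(4) .
  have sN: "sharp (lie_poisson br) p ` conormal_space C p = ?s p ` h" if "p \<in> C" for p
    using annihilator_annihilator[OF assms(1)] assms(3)
    by (simp add: conormal_space_def T[OF that] lie_subalgebra_def image_image)
  have sharp_diff: "?s p v - ?s lam v \<in> ?A" if p: "p \<in> C" and v: "v \<in> h" for p v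
  proof -
    obtain \<phi> where "\<phi> \<in> ?A" "p = \<phi> + lam" using p assms(4) by blast
    then show ?thesis
      using sharp_in_annihilator[OF assms(1-3) _ v] by (simp add: sharp_lie_poisson_add[OF assms(1,2)])
  qed
  have "{X + Y |X Y. X \<in> ?A \<and> Y \<in> ?s p ` h} = {X + Y |X Y. X \<in> ?A \<and> Y \<in> ?s lam ` h}"
    if p: "p \<in> C" for p
  proof (intro set_eqI iffI)
    fix Z assume "Z \<in> {X + Y |X Y. X \<in> ?A \<and> Y \<in> ?s p ` h}"
    then obtain X v where "X \<in> ?A" "v \<in> h" "Z = X + ?s p v" by blast
    then have "Z = (X + (?s p v - ?s lam v)) + ?s lam v" "X + (?s p v - ?s lam v) \<in> ?A"
      using subspace_add[OF subspace_annihilator _ sharp_diff[OF p]] by auto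
    with \<open>v \<in> h\<close> show "Z \<in> {X + Y |X Y. X \<in> ?A \<and> Y \<in> ?s lam ` h}" by blast
  next
    fix Z assume "Z \<in> {X + Y |X Y. X \<in> ?A \<and> Y \<in> ?s lam ` h}"
    then obtain X v where "X \<in> ?A" "v \<in> h" "Z = X + ?s lam v" by blast
    then have "Z = (X - (?s p v - ?s lam v)) + ?s p v" "X - (?s p v - ?s lam v) \<in> ?A"
      using subspace_diff[OF subspace_annihilator _ sharp_diff[OF p]] by auto
    with \<open>v \<in> h\<close> show "Z \<in> {X + Y |X Y. X \<in> ?A \<and> Y \<in> ?s p ` h}" by blast
  qed
  then have pre: "pre_Poisson (lie_poisson br) C"
    unfolding pre_Poisson_def by (simp add: T sN)
  have lam: "lam \<in> C"
    using subspace_0[OF subspace_annihilator, of h] unfolding assms(4) by force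
  have "?s p v \<in> ?A \<longleftrightarrow> ?s lam v \<in> ?A" if "p \<in> C" "v \<in> h" for p v
    using subspace_add[OF subspace_annihilator _ sharp_diff[OF that], of "?s lam v"]
      subspace_diff[OF subspace_annihilator _ sharp_diff[OF that], of "?s p v"]
    by (auto simp: algebra_simps)
  then have "(\<forall>p\<in>C. \<forall>v\<in>h. ?s p v \<in> ?A) \<longleftrightarrow> (\<forall>v\<in>h. ?s lam v \<in> ?A)"
    using lam by blast
  then have "coisotropic (lie_poisson br) C \<longleftrightarrow> (\<forall>v\<in>h. ?s lam v \<in> ?A)"
    by (simp add: coisotropic_def T sN image_subset_iff)
  also have "\<dots> \<longleftrightarrow> lam \<in> annihilator (bracket_span br h h)"
    unfolding annihilator_bracket_span
    by (simp add: annihilator_def sharp_lie_poisson_ev[OF assms(1,2)])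
  finally show ?thesis using pre by blast
qed

end
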